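(* Let $m,n,k$ be positive integers with $m\le n$ and $k\le n$, and let $q$ be an integer with $1\le q\le k$. Then $$M_R(m,n,k)\le\left(\sqrt{(q+k-1)(k-1)^{q-1}}\right)^{\frac mq-\frac nk\frac{q-1}{q}}k^{\frac{n(q-1)}{2k}}.$$ In particular (case $m=n$), setting $$c_{q,k}=(q+k-1)^{\frac1{2q}\left(1-\frac{q-1}{k}\right)}(k-1)^{\frac12\frac{q-1}{q}\left(1-\frac{q-1}{k}\right)}k^{\frac{q-1}{2k}},$$ one has $M_R(n,k)\le c_{q,k}^{\,n}$.
   Context: $R(m,n,k)$ denotes the set of $m\times n$ matrices with entries in $\{0,1\}$ each of whose rows sums to the integer $k$; $R(n,k)=R(n,n,k)$. For a real $m\times n$ matrix $A$ with $m\le n$, $\mathrm{Vol}(A)=\sqrt{\det(AA^T)}$. $M_R(m,n,k)=\max_{A\in R(m,n,k)}\mathrm{Vol}(A)$ and $M_R(n,k)=\max_{A\in R(n,k)}\det(A)$. The convention $0^0=1$ is used (relevant only when $q=k=1$). *)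

theory Defs
  imports Complex_Main "Jordan_Normal_Form.Determinant"
begin

definition R :: "nat \<Rightarrow> nat \<Rightarrow> nat \<Rightarrow> real mat set" where
  "R m n k = {A \<in> carrier_mat m n.
     (\<forall>i<m. \<forall>j<n. A $$ (i, j) \<in> {0, 1}) \<and>
     (\<forall>i<m. (\<Sum>j<n. A $$ (i, j)) = real k)}"

definition Vol :: "real mat \<Rightarrow> real" where
  "Vol A = sqrt (det (A * transpose_mat A))"

definition max_vol :: "nat \<Rightarrow> nat \<Rightarrow> nat \<Rightarrow> real" where
  "max_vol m n k = Max (Vol ` R m n k)"

definition max_det :: "nat \<Rightarrow> nat \<Rightarrow> real" where
  "max_det n k = Max (det ` R n n k)"

text \<open>The lemmas \<open>finite_R\<close> and \<open>R_nonempty\<close> show that both maxima are attained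
  when \<open>k \<le> n\<close>.\<close>

lemma finite_R: "finite (R m n k)"
proof (rule finite_subset)
  let ?F = "({..<m} \<times> {..<n}) \<rightarrow>\<^sub>E {0, 1 :: real}"
  show "R m n k \<subseteq> (\<lambda>f. mat m n f) ` ?F"
  proof
    fix A assume A: "A \<in> R m n k"
    let ?f = "restrict (\<lambda>ij. A $$ ij) ({..<m} \<times> {..<n})"
    have "A = mat m n ?f" using A by (intro eq_matI) (auto simp: R_def)
    moreover have "?f \<in> ?F" using A by (auto simp: R_def)
    ultimately show "A \<in> (\<lambda>f. mat m n f) ` ?F" by blast
  qed
  show "finite ((\<lambda>f. mat m n f) ` ?F)"
    by (intro finite_imageI finite_PiE) auto
qed

lemma R_nonempty:
  assumes "k \<le> n"
  shows "R m n k \<noteq> {}"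
proof -
  have "(\<Sum>j<n. if j < k then 1 else 0 :: real) = real k"
  proof -
    have "{..<n} \<inter> {j. j < k} = {..<k}" using assms by auto
    then show ?thesis by (simp add: sum.If_cases)
  qed
  then have "mat m n (\<lambda>(i, j). if j < k then 1 else 0) \<in> R m n k"
    by (auto simp: R_def)
  then show ?thesis by blast
qed

text \<open>Real power with the convention \<open>0\<^sup>0 = 1\<close>; the library has \<open>0 powr 0 = 0\<close>.\<close>

definition rpow :: "real \<Rightarrow> real \<Rightarrow> real" where
  "rpow x a = (if a = 0 then 1 else x powr a)"

text \<open>For \<open>1 \<le> q \<le> k\<close> the factor with base \<open>k - 1\<close> is the only one whose base can
  vanish, namely for \<open>q = k = 1\<close>, and its exponent is then \<open>0\<close>.\<close>

definition c :: "nat \<Rightarrow> nat \<Rightarrow> real" where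
  "c q k =
     (real q + real k - 1) powr (1 / (2 * real q) * (1 - (real q - 1) / real k)) *
     rpow (real k - 1) (1 / 2 * ((real q - 1) / real q) * (1 - (real q - 1) / real k)) *
     real k powr ((real q - 1) / (2 * real k))"

end

theory Submission
  imports Defs
begin

text \<open>The squared volume of a matrix is the Gram determinant of its rows. Fischer's inequality
  (\<open>gram_append_le\<close>) says that splitting the rows into blocks can only increase the product of
  the Gram determinants, so it suffices to choose blocks whose determinants are small.

  A good block consists of \<open>q\<close> rows that all have a \<open>1\<close> in the same column. Its Gram matrix has
  \<open>k\<close> on the diagonal and entries at least \<open>1\<close> elsewhere, and among such positive semidefinite
  matrices the determinant is largest for \<open>(k - 1) I + J\<close>, with \<open>J\<close> the all-ones matrix, where
  it is \<open>F = (q + k - 1) (k - 1)\<^sup>q\<^sup>-\<^sup>1\<close> (\<open>gram_le_equiangular\<close>). The reason is that the entry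
  sum bounds the quadratic form at the unit vector \<open>u = (1, \<dots>, 1) / \<surd>q\<close> from below by
  \<open>q + k - 1\<close>: rotating \<open>u\<close> to a coordinate axis gives a Gram matrix with the same trace
  \<open>q k\<close> and determinant but one large diagonal entry, and Hadamard's inequality together with
  the inequality of arithmetic and geometric means gives the bound.

  As long as the number \<open>r\<close> of rows satisfies \<open>r k > n (q - 1)\<close>, the \<open>r k\<close> ones cannot be
  spread over the \<open>n\<close> columns with fewer than \<open>q\<close> in each, so a good block can be removed.
  After \<open>g\<close> removals \<open>r = m - q g \<le> n (q - 1) / k\<close> rows are left, which contribute at most
  \<open>k\<close> each (\<open>gram_zero_one_rows_grouped\<close>). Thus \<open>Vol\<^sup>2 \<le> F\<^sup>g k\<^sup>m\<^sup>-\<^sup>q\<^sup>g\<close>. Since \<open>F \<le> k\<^sup>q\<close>, this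
  expression decreases in \<open>g\<close>, so \<open>g\<close> may be lowered to the real number for which
  \<open>m - q g = n (q - 1) / k\<close>, and this is the stated bound. For square matrices the determinant
  is at most the volume, and the bound is \<open>c\<^sup>n\<close>.\<close>

section \<open>Gram determinants\<close>

definition gram :: "nat \<Rightarrow> real vec list \<Rightarrow> real" where
  "gram n vs = det (mat_of_rows n vs * (mat_of_rows n vs)\<^sup>T)"

lemma gram_matrix_index:
  assumes "set vs \<subseteq> carrier_vec n" "i < length vs" "j < length vs"
  shows "(mat_of_rows n vs * (mat_of_rows n vs)\<^sup>T) $$ (i, j) = vs ! i \<bullet> vs ! j"
proof -
  have "vs ! i \<in> carrier_vec n" "vs ! j \<in> carrier_vec n"
    using assms by (auto dest: nth_mem)
  then show ?thesis using assms by simp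
qed

lemma gram_matrix_carrier [simp]:
  "mat_of_rows n vs * (mat_of_rows n vs)\<^sup>T \<in> carrier_mat (length vs) (length vs)"
  by (rule mult_carrier_mat[of _ _ n]) simp_all

lemma det_gram_mult:
  fixes A E :: "real mat"
  assumes A: "A \<in> carrier_mat r n" and E: "E \<in> carrier_mat r r"
  shows "det ((E * A) * (E * A)\<^sup>T) = (det E)\<^sup>2 * det (A * A\<^sup>T)"
proof -
  have "(E * A) * (E * A)\<^sup>T = E * ((A * A\<^sup>T) * E\<^sup>T)"
    using A E by (simp add: transpose_mult assoc_mult_mat[where ?n\<^sub>1 = r])
      (smt (verit) A E assoc_mult_mat mult_carrier_mat transpose_carrier_mat)
  moreover have "A * A\<^sup>T \<in> carrier_mat r r" using A by simp
  ultimately show ?thesis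
    using E by (simp add: det_mult[of _ r] det_transpose power2_eq_square)
qed

text \<open>Subtracting from one row a combination of the others multiplies the matrix of rows from the
  left by a unitriangular matrix, so it does not change the Gram determinant.\<close>

lemma gram_Cons_sub_combination:
  assumes us: "set us \<subseteq> carrier_vec n" and v: "v \<in> carrier_vec n"
    and d: "d \<in> carrier_vec (length us)"
  shows "gram n ((v - (mat_of_rows n us)\<^sup>T *\<^sub>v d) # us) = gram n (v # us)"
proof -
  let ?r = "length us"
  let ?w = "v - (mat_of_rows n us)\<^sup>T *\<^sub>v d"
  (* the elementary matrix with first row (1, -d) and the identity below *)
  define E where "E = mat (Suc ?r) (Suc ?r)
    (\<lambda>(i, j). if i = j then 1 else if i = 0 then - d $ (j - 1) else (0 :: real))"
  have E: "E \<in> carrier_mat (Suc ?r) (Suc ?r)" by (simp add: E_def)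
  have "upper_triangular E" by (auto simp: E_def)
  then have "det E = prod_list (diag_mat E)" using E by (rule det_upper_triangular)
  also have "diag_mat E = replicate (Suc ?r) 1"
    by (rule nth_equalityI) (auto simp: diag_mat_def E_def simp del: upt_Suc replicate_Suc)
  finally have detE: "det E = 1" by simp
  have "mat_of_rows n (?w # us) = E * mat_of_rows n (v # us)"
  proof (rule eq_matI)
    fix i j assume "i < dim_row (E * mat_of_rows n (v # us))"
      and "j < dim_col (E * mat_of_rows n (v # us))"
    then have i: "i < Suc ?r" and j: "j < n" by (simp_all add: E_def)
    have "(E * mat_of_rows n (v # us)) $$ (i, j)
        = (\<Sum>l<Suc ?r. E $$ (i, l) * (v # us) ! l $ j)"
      using i j E
      by (auto simp: scalar_prod_def mat_of_rows_index atLeast0LessThan intro!: sum.cong)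
    also have "\<dots> = (?w # us) ! i $ j"
    proof (cases i)
      case 0
      then show ?thesis using j v d us
        by (simp add: sum.lessThan_Suc_shift E_def scalar_prod_def mat_of_rows_index
            atLeast0LessThan sum_negf mult.commute del: sum.lessThan_Suc)
    next
      case (Suc i')
      then have "(\<Sum>l<Suc ?r. E $$ (i, l) * (v # us) ! l $ j)
          = (\<Sum>l<Suc ?r. if i = l then (v # us) ! l $ j else 0)"
        using i by (intro sum.cong) (auto simp: E_def)
      then show ?thesis using i Suc by (simp del: sum.lessThan_Suc)
    qed
    finally show "mat_of_rows n (?w # us) $$ (i, j)
        = (E * mat_of_rows n (v # us)) $$ (i, j)"
      using i j by (simp add: mat_of_rows_index)
  qed (simp_all add: E_def)
  moreover have "mat_of_rows n (v # us) \<in> carrier_mat (Suc ?r) n"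
    using mat_of_rows_carrier(1)[of n "v # us"] by simp
  ultimately show ?thesis
    using det_gram_mult[OF _ E, of "mat_of_rows n (v # us)" n] detE
    by (simp add: gram_def)
qed

text \<open>Orthogonality makes the Gram matrix block diagonal.\<close>

lemma gram_Cons_orthogonal:
  assumes us: "set us \<subseteq> carrier_vec n" and w: "w \<in> carrier_vec n"
    and orth: "mat_of_rows n us *\<^sub>v w = 0\<^sub>v (length us)"
  shows "gram n (w # us) = (w \<bullet> w) * gram n us"
proof -
  let ?r = "length us"
  let ?G = "\<lambda>vs. mat_of_rows n vs * (mat_of_rows n vs)\<^sup>T"
  have wu: "us ! i \<bullet> w = 0" if "i < ?r" for i
  proof -
    have "us ! i \<in> carrier_vec n" using us that by (auto dest: nth_mem)
    then show ?thesis using arg_cong[OF orth, of "\<lambda>x. x $ i"] that by simp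
  qed
  have uw: "w \<bullet> us ! i = 0" if "i < ?r" for i
  proof -
    have "us ! i \<in> carrier_vec n" using us that by (auto dest: nth_mem)
    then show ?thesis using wu[OF that] w by (simp add: comm_scalar_prod)
  qed
  have wus: "set (w # us) \<subseteq> carrier_vec n" using us w by simp
  have "?G (w # us)
      = four_block_mat (mat 1 1 (\<lambda>_. w \<bullet> w)) (0\<^sub>m 1 ?r) (0\<^sub>m ?r 1) (?G us)"
  proof (rule eq_matI)
    fix i j
    assume "i < dim_row (four_block_mat (mat 1 1 (\<lambda>_. w \<bullet> w)) (0\<^sub>m 1 ?r) (0\<^sub>m ?r 1) (?G us))"
      and "j < dim_col (four_block_mat (mat 1 1 (\<lambda>_. w \<bullet> w)) (0\<^sub>m 1 ?r) (0\<^sub>m ?r 1) (?G us))"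
    then have ij: "i < Suc ?r" "j < Suc ?r" by simp_all
    then have "?G (w # us) $$ (i, j) = (w # us) ! i \<bullet> (w # us) ! j"
      using gram_matrix_index[OF wus] by simp
    moreover have "?G us $$ (a, b) = us ! a \<bullet> us ! b" if "a < ?r" "b < ?r" for a b
      using gram_matrix_index[OF us that] .
    ultimately show "?G (w # us) $$ (i, j)
      = four_block_mat (mat 1 1 (\<lambda>_. w \<bullet> w)) (0\<^sub>m 1 ?r) (0\<^sub>m ?r 1) (?G us) $$ (i, j)"
      using ij wu uw by (cases i; cases j) (simp_all del: index_mult_mat(1))
  qed simp_all
  also have "det \<dots> = det (mat 1 1 (\<lambda>_. w \<bullet> w)) * det (?G us)"
    by (rule det_four_block_mat_lower_left_zero_col[OF _ _ refl gram_matrix_carrier]) simp_all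
  finally show ?thesis by (simp add: gram_def det_single)
qed

text \<open>The normal equations of least squares: \<open>d\<close> solves \<open>A A\<^sup>T d = A v\<close>, so \<open>A\<^sup>T d\<close> is the
  orthogonal projection of \<open>v\<close> onto the row space.\<close>

lemma orthogonal_residual_exists:
  fixes A :: "real mat"
  assumes A: "A \<in> carrier_mat r n" and v: "v \<in> carrier_vec n"
    and det: "det (A * A\<^sup>T) \<noteq> 0"
  shows "\<exists>d \<in> carrier_vec r. A *\<^sub>v (v - A\<^sup>T *\<^sub>v d) = 0\<^sub>v r"
proof -
  have G: "A * A\<^sup>T \<in> carrier_mat r r" using A by simp
  from det_non_zero_imp_unit[OF G det, of "()"]
  obtain B where B: "B \<in> carrier_mat r r" and inv: "A * A\<^sup>T * B = 1\<^sub>m r"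
    by (auto simp: Units_def ring_mat_def)
  let ?d = "B *\<^sub>v (A *\<^sub>v v)"
  have Av: "A *\<^sub>v v \<in> carrier_vec r" using A v by simp
  have d: "?d \<in> carrier_vec r" using B Av by (rule mult_mat_vec_carrier)
  have "A *\<^sub>v (A\<^sup>T *\<^sub>v ?d) = (A * A\<^sup>T) *\<^sub>v ?d"
    using A d by (simp add: assoc_mult_mat_vec[of A r n "A\<^sup>T" r])
  also have "\<dots> = (A * A\<^sup>T * B) *\<^sub>v (A *\<^sub>v v)"
    using G B Av by (simp add: assoc_mult_mat_vec[of _ r r B r])
  also have "\<dots> = A *\<^sub>v v" using inv Av by simp
  finally have "A *\<^sub>v (v - A\<^sup>T *\<^sub>v ?d) = A *\<^sub>v v - A *\<^sub>v v"
    using A v d by (simp add: mult_minus_distrib_mat_vec[of A r n])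
  then show ?thesis using d Av by (intro bexI[of _ ?d]) auto
qed


lemma scalar_prod_self_nonneg: "0 \<le> (w :: real vec) \<bullet> w"
  unfolding scalar_prod_def by (rule sum_nonneg) simp

lemma scalar_prod_self_eq_0:
  fixes w :: "real vec"
  assumes "w \<bullet> w = 0" and "w \<in> carrier_vec n"
  shows "w = 0\<^sub>v n"
proof -
  have "\<forall>i\<in>{0..<dim_vec w}. w $ i * w $ i = 0"
    using assms by (subst sum_nonneg_eq_0_iff[symmetric]) (auto simp: scalar_prod_def)
  then show ?thesis using assms by (intro eq_vecI) auto
qed

text \<open>A vanishing Gram determinant means that the rows are linearly dependent: if \<open>A A\<^sup>T x = 0\<close>,
  then \<open>A\<^sup>T x\<close> has norm \<open>0\<close>. A dependence persists when a further row is added.\<close>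

lemma gram_Cons_eq_0:
  assumes us: "set us \<subseteq> carrier_vec n" and v: "v \<in> carrier_vec n"
    and "gram n us = 0"
  shows "gram n (v # us) = 0"
proof -
  let ?r = "length us"
  let ?A = "mat_of_rows n us" and ?B = "mat_of_rows n (v # us)"
  have B: "?B \<in> carrier_mat (Suc ?r) n"
    using mat_of_rows_carrier(1)[of n "v # us"] by simp
  obtain x where x: "x \<in> carrier_vec ?r" "x \<noteq> 0\<^sub>v ?r"
    and Gx: "(?A * ?A\<^sup>T) *\<^sub>v x = 0\<^sub>v ?r"
    using assms(3) det_0_iff_vec_prod_zero_field[OF gram_matrix_carrier]
    unfolding gram_def by blast
  have y: "?A\<^sup>T *\<^sub>v x \<in> carrier_vec n" by (rule mult_mat_vec_carrier[of _ _ ?r]) (use x in auto)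
  have "?A *\<^sub>v (?A\<^sup>T *\<^sub>v x) = 0\<^sub>v ?r"
    using Gx x by (simp add: assoc_mult_mat_vec[of ?A ?r n "?A\<^sup>T" ?r])
  then have "(?A\<^sup>T *\<^sub>v x) \<bullet> (?A\<^sup>T *\<^sub>v x) = 0"
    using transpose_vec_mult_scalar[OF mat_of_rows_carrier(1) y x(1)] x(1) by simp
  then have Ax: "?A\<^sup>T *\<^sub>v x = 0\<^sub>v n"
    using x y by (intro scalar_prod_self_eq_0) auto
  have "?B\<^sup>T *\<^sub>v vCons 0 x = ?A\<^sup>T *\<^sub>v x"
  proof (rule eq_vecI)
    fix j assume "j < dim_vec (?A\<^sup>T *\<^sub>v x)"
    then have j: "j < n" by simp
    have "(?B\<^sup>T *\<^sub>v vCons 0 x) $ j = (\<Sum>l<Suc ?r. (v # us) ! l $ j * vCons 0 x $ l)"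
      using j x by (auto simp: scalar_prod_def mat_of_rows_index atLeast0LessThan
          intro!: sum.cong)
    also have "\<dots> = (?A\<^sup>T *\<^sub>v x) $ j"
      unfolding sum.lessThan_Suc_shift using j x
      by (auto simp: scalar_prod_def mat_of_rows_index atLeast0LessThan)
    finally show "(?B\<^sup>T *\<^sub>v vCons 0 x) $ j = (?A\<^sup>T *\<^sub>v x) $ j" .
  qed simp
  then have "(?B * ?B\<^sup>T) *\<^sub>v vCons 0 x = ?B *\<^sub>v 0\<^sub>v n"
    using B x Ax by (simp add: assoc_mult_mat_vec[of ?B "Suc ?r" n "?B\<^sup>T" "Suc ?r"])
  also have "\<dots> = 0\<^sub>v (Suc ?r)" by (intro eq_vecI) (auto simp: scalar_prod_def)
  finally have "(?B * ?B\<^sup>T) *\<^sub>v vCons 0 x = 0\<^sub>v (Suc ?r)" .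
  moreover have "vCons 0 x \<noteq> 0\<^sub>v (Suc ?r)" using x(2) unfolding zero_vec_Suc vCons_eq_vCons by simp
  moreover have "vCons 0 x \<in> carrier_vec (Suc ?r)" using x by simp
  ultimately have "\<exists>z. z \<in> carrier_vec (length (v # us)) \<and> z \<noteq> 0\<^sub>v (length (v # us))
      \<and> (?B * ?B\<^sup>T) *\<^sub>v z = 0\<^sub>v (length (v # us))"
    by (intro exI[of _ "vCons 0 x"]) simp
  then show ?thesis
    unfolding gram_def by (rule det_0_iff_vec_prod_zero_field[OF gram_matrix_carrier, THEN iffD2])
qed

text \<open>The ratio of the two Gram determinants is the squared distance of \<open>v\<close> from the span of
  \<open>us\<close>, attained at the orthogonal projection. For dependent \<open>us\<close> both determinants
  vanish by \<open>gram_Cons_eq_0\<close>, and the ratio carries no information.\<close>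

lemma gram_Cons_distance:
  assumes us: "set us \<subseteq> carrier_vec n" and v: "v \<in> carrier_vec n"
    and "gram n us \<noteq> 0"
  obtains d where "d \<in> carrier_vec (length us)"
    and "mat_of_rows n us *\<^sub>v (v - (mat_of_rows n us)\<^sup>T *\<^sub>v d) = 0\<^sub>v (length us)"
    and "gram n (v # us) = ((v - (mat_of_rows n us)\<^sup>T *\<^sub>v d) \<bullet> (v - (mat_of_rows n us)\<^sup>T *\<^sub>v d))
      * gram n us"
proof -
  let ?A = "mat_of_rows n us"
  obtain d where d: "d \<in> carrier_vec (length us)"
    and orth: "?A *\<^sub>v (v - ?A\<^sup>T *\<^sub>v d) = 0\<^sub>v (length us)"
    using orthogonal_residual_exists[of ?A "length us" n v] v assms(3)
    unfolding gram_def by auto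
  have "v - ?A\<^sup>T *\<^sub>v d \<in> carrier_vec n"
    using v d by (auto intro!: minus_carrier_vec mult_mat_vec_carrier[of _ _ "length us"])
  from gram_Cons_orthogonal[OF us this orth] show thesis
    unfolding gram_Cons_sub_combination[OF us v d] by (rule that[OF d orth])
qed

lemma gram_Nil [simp]: "gram n [] = 1"
  using det_dim_zero[OF gram_matrix_carrier[of n "[]", simplified list.size]] by (simp only: gram_def)

lemma gram_nonneg: "set vs \<subseteq> carrier_vec n \<Longrightarrow> 0 \<le> gram n vs"
proof (induction vs)
  case (Cons v vs)
  show ?case
  proof (cases "gram n vs = 0")
    case False
    with Cons.prems obtain d where
      "gram n (v # vs) = ((v - (mat_of_rows n vs)\<^sup>T *\<^sub>v d) \<bullet> (v - (mat_of_rows n vs)\<^sup>T *\<^sub>v d))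
        * gram n vs"
      using gram_Cons_distance[of vs n v] by auto
    then show ?thesis using Cons by (simp add: scalar_prod_self_nonneg)
  next
    case True
    then have "gram n (v # vs) = 0" using Cons.prems by (intro gram_Cons_eq_0) auto
    then show ?thesis by simp
  qed
qed simp

text \<open>Every point of the span is at least as far from \<open>v\<close> as the projection, by Pythagoras.\<close>

lemma gram_Cons_le:
  assumes us: "set us \<subseteq> carrier_vec n" and v: "v \<in> carrier_vec n"
    and e: "e \<in> carrier_vec (length us)"
  shows "gram n (v # us)
    \<le> ((v - (mat_of_rows n us)\<^sup>T *\<^sub>v e) \<bullet> (v - (mat_of_rows n us)\<^sup>T *\<^sub>v e)) * gram n us"
proof (cases "gram n us = 0")
  case True
  then show ?thesis using gram_Cons_eq_0[OF us v] by simp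
next
  case False
  let ?A = "mat_of_rows n us"
  obtain d where d: "d \<in> carrier_vec (length us)"
    and orth: "?A *\<^sub>v (v - ?A\<^sup>T *\<^sub>v d) = 0\<^sub>v (length us)"
    and eq: "gram n (v # us) = ((v - ?A\<^sup>T *\<^sub>v d) \<bullet> (v - ?A\<^sup>T *\<^sub>v d)) * gram n us"
    using gram_Cons_distance[OF us v False] by blast
  define w where "w = v - ?A\<^sup>T *\<^sub>v d"
  define y where "y = ?A\<^sup>T *\<^sub>v (d - e)"
  have At: "?A\<^sup>T \<in> carrier_mat n (length us)" by simp
  have c: "?A\<^sup>T *\<^sub>v d \<in> carrier_vec n" "?A\<^sup>T *\<^sub>v e \<in> carrier_vec n"
    using mult_mat_vec_carrier[OF At] d e by auto
  have w: "w \<in> carrier_vec n" and y: "y \<in> carrier_vec n"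
    using c v mult_mat_vec_carrier[OF At] d e unfolding w_def y_def by auto
  have split: "v - ?A\<^sup>T *\<^sub>v e = w + y"
    unfolding w_def y_def mult_minus_distrib_mat_vec[OF At d e]
    using c v by (intro eq_vecI) auto
  have "y \<bullet> w = (d - e) \<bullet> (?A *\<^sub>v w)"
    unfolding y_def using transpose_vec_mult_scalar[of ?A "length us" n w "d - e"] w d e
    by simp
  also have "\<dots> = 0" using orth d e by (simp add: w_def)
  finally have yw: "y \<bullet> w = 0" .
  then have "w \<bullet> y = 0" using w y by (simp add: comm_scalar_prod)
  with yw have "(w + y) \<bullet> (w + y) = w \<bullet> w + y \<bullet> y"
    using w y by (simp add: scalar_prod_add_distrib[of _ n] add_scalar_prod_distrib[of _ n])
  then have "w \<bullet> w \<le> (v - ?A\<^sup>T *\<^sub>v e) \<bullet> (v - ?A\<^sup>T *\<^sub>v e)"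
    unfolding split using scalar_prod_self_nonneg[of y] by simp
  then show ?thesis
    unfolding eq w_def using gram_nonneg[OF us] by (intro mult_right_mono)
qed

text \<open>Fischer's inequality. The distance from \<open>v\<close> to the span of \<open>us @ ws\<close> is at most its distance
  to the smaller span of \<open>us\<close>, so adding \<open>v\<close> multiplies the left-hand side by at most the factor
  by which it multiplies \<open>gram n us\<close>.\<close>

theorem gram_append_le:
  assumes "set us \<subseteq> carrier_vec n" and "set ws \<subseteq> carrier_vec n"
  shows "gram n (us @ ws) \<le> gram n us * gram n ws"
  using assms(1)
proof (induction us)
  case (Cons v us)
  then have us: "set us \<subseteq> carrier_vec n" and v: "v \<in> carrier_vec n"
    and IH: "gram n (us @ ws) \<le> gram n us * gram n ws" by auto
  have usws: "set (us @ ws) \<subseteq> carrier_vec n" using us assms(2) by simp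
  let ?A = "mat_of_rows n us" and ?B = "mat_of_rows n (us @ ws)"
  show ?case
  proof (cases "gram n us = 0")
    case True
    then have "gram n (us @ ws) = 0" using IH gram_nonneg[OF usws] by simp
    then have "gram n (v # us @ ws) = 0" using gram_Cons_eq_0[OF usws v] by simp
    moreover have "gram n (v # us) = 0" using gram_Cons_eq_0[OF us v True] .
    ultimately show ?thesis by simp
  next
    case False
    obtain d where d: "d \<in> carrier_vec (length us)"
      and eq: "gram n (v # us) = ((v - ?A\<^sup>T *\<^sub>v d) \<bullet> (v - ?A\<^sup>T *\<^sub>v d)) * gram n us"
      using gram_Cons_distance[OF us v False] by blast
    (* pad the coefficients of the projection onto the span of us by zeros *)
    define e where "e = d @\<^sub>v 0\<^sub>v (length ws)"
    have e: "e \<in> carrier_vec (length (us @ ws))" using d by (simp add: e_def)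
    have Be: "?B\<^sup>T *\<^sub>v e = ?A\<^sup>T *\<^sub>v d"
    proof (rule eq_vecI)
      fix j assume "j < dim_vec (?A\<^sup>T *\<^sub>v d)"
      then have j: "j < n" by simp
      have "(?B\<^sup>T *\<^sub>v e) $ j = (\<Sum>l<length us + length ws. (us @ ws) ! l $ j * e $ l)"
        using j d by (auto simp: e_def scalar_prod_def mat_of_rows_index atLeast0LessThan
            intro!: sum.cong)
      also have "\<dots> = (\<Sum>l<length us. us ! l $ j * d $ l)"
        using d by (intro sum.mono_neutral_cong_right) (auto simp: e_def nth_append)
      also have "\<dots> = (?A\<^sup>T *\<^sub>v d) $ j"
        using j d by (auto simp: scalar_prod_def mat_of_rows_index atLeast0LessThan
            intro!: sum.cong)
      finally show "(?B\<^sup>T *\<^sub>v e) $ j = (?A\<^sup>T *\<^sub>v d) $ j" .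
    qed simp
    have "gram n (v # us @ ws)
        \<le> ((v - ?A\<^sup>T *\<^sub>v d) \<bullet> (v - ?A\<^sup>T *\<^sub>v d)) * gram n (us @ ws)"
      using gram_Cons_le[OF usws v e] unfolding Be .
    also have "\<dots> \<le> ((v - ?A\<^sup>T *\<^sub>v d) \<bullet> (v - ?A\<^sup>T *\<^sub>v d)) * (gram n us * gram n ws)"
      using IH scalar_prod_self_nonneg by (rule mult_left_mono)
    finally show ?thesis using eq by (simp add: mult.assoc)
  qed
qed simp

text \<open>Hadamard's inequality: \<open>0\<close> lies in the span of the remaining rows.\<close>

theorem gram_le_prod_norms:
  "set vs \<subseteq> carrier_vec n \<Longrightarrow> gram n vs \<le> prod_list (map (\<lambda>v. v \<bullet> v) vs)"
proof (induction vs)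
  case (Cons v vs)
  then have vs: "set vs \<subseteq> carrier_vec n" and v: "v \<in> carrier_vec n" by auto
  let ?A = "mat_of_rows n vs"
  have "?A\<^sup>T *\<^sub>v 0\<^sub>v (length vs) = 0\<^sub>v n" by (intro eq_vecI) auto
  then have "gram n (v # vs) \<le> (v \<bullet> v) * gram n vs"
    using gram_Cons_le[OF vs v, of "0\<^sub>v (length vs)"] v by simp
  also have "\<dots> \<le> (v \<bullet> v) * prod_list (map (\<lambda>v. v \<bullet> v) vs)"
    using Cons.IH[OF vs] scalar_prod_self_nonneg by (rule mult_left_mono)
  finally show ?case by simp
qed simp

text \<open>Reordering the vectors permutes rows and columns of the Gram matrix simultaneously, so the
  two signs cancel.\<close>

lemma gram_mset_cong:
  assumes vs: "set vs \<subseteq> carrier_vec n" and eq: "mset us = mset vs"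
  shows "gram n us = gram n vs"
proof -
  obtain p where p: "p permutes {..<length vs}" and us: "us = permute_list p vs"
    using mset_eq_permutation[OF eq] by metis
  let ?r = "length vs"
  let ?G = "mat_of_rows n vs * (mat_of_rows n vs)\<^sup>T"
  let ?H = "mat ?r ?r (\<lambda>(i, j). ?G\<^sup>T $$ (p i, j))"
  have p': "p permutes {0..<?r}" using p by (simp add: atLeast0LessThan)
  have p_less: "p i < ?r" if "i < ?r" for i using permutes_in_image[OF p] that by simp
  have us': "set us \<subseteq> carrier_vec n" "length us = ?r"
    using vs us p by simp_all
  (* H permutes the columns of G, up to transposition; permuting the rows of its transpose
     then permutes both *)
  have "mat_of_rows n us * (mat_of_rows n us)\<^sup>T = mat ?r ?r (\<lambda>(i, j). ?H\<^sup>T $$ (p i, j))"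
  proof (rule eq_matI)
    fix i j assume "i < dim_row (mat ?r ?r (\<lambda>(i, j). ?H\<^sup>T $$ (p i, j)))"
      and "j < dim_col (mat ?r ?r (\<lambda>(i, j). ?H\<^sup>T $$ (p i, j)))"
    then have ij: "i < ?r" "j < ?r" by simp_all
    have "(mat_of_rows n us * (mat_of_rows n us)\<^sup>T) $$ (i, j) = us ! i \<bullet> us ! j"
      by (rule gram_matrix_index) (use us' ij in auto)
    also have "\<dots> = vs ! p i \<bullet> vs ! p j"
      using us p ij by (simp add: permute_list_nth)
    also have "\<dots> = ?G $$ (p i, p j)"
      by (rule gram_matrix_index[symmetric]) (use vs p_less ij in auto)
    finally show "(mat_of_rows n us * (mat_of_rows n us)\<^sup>T) $$ (i, j)
        = mat ?r ?r (\<lambda>(i, j). ?H\<^sup>T $$ (p i, j)) $$ (i, j)"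
      using ij p_less by simp
  qed (use us' in simp_all)
  then have "gram n us = signof p * det (?H\<^sup>T)"
    unfolding gram_def using det_permute_rows[OF _ p', of "?H\<^sup>T"] by simp
  also have "det (?H\<^sup>T) = det ?H" by (rule det_transpose[of _ ?r]) simp
  also have "det ?H = signof p * det (?G\<^sup>T)"
    by (rule det_permute_rows[OF _ p']) simp
  also have "det (?G\<^sup>T) = gram n vs"
    unfolding gram_def by (rule det_transpose[OF gram_matrix_carrier])
  also have "signof p * (signof p * gram n vs) = gram n vs"
    by (simp add: sign_def)
  finally show ?thesis .
qed

section \<open>Vectors with pairwise inner products bounded below\<close>

text \<open>The inequality of arithmetic and geometric means for mean at most \<open>1\<close>; it follows directly
  from \<open>x \<le> exp (x - 1)\<close>.\<close>

lemma prod_le_1_if_sum_le_card: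
  fixes y :: "'a \<Rightarrow> real"
  assumes "finite I" and "\<And>i. i \<in> I \<Longrightarrow> 0 \<le> y i" and "sum y I \<le> real (card I)"
  shows "prod y I \<le> 1"
proof -
  have "y i \<le> exp (y i - 1)" for i
    using exp_ge_add_one_self[of "y i - 1"] by simp
  then have "prod y I \<le> (\<Prod>i\<in>I. exp (y i - 1))"
    using assms(2) by (intro prod_mono) auto
  also have "\<dots> = exp (sum y I - real (card I))"
    using assms(1) by (simp add: exp_sum[symmetric] sum_subtractf)
  also have "\<dots> \<le> 1" using assms(3) by simp
  finally show ?thesis .
qed

text \<open>The Householder reflection that exchanges the unit vectors \<open>e\<^sub>0\<close> and
  \<open>(1, \<dots>, 1) / \<surd>q\<close>.\<close>

lemma involution_with_constant_first_row:
  assumes "0 < q"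
  obtains Q :: "real mat" where "Q \<in> carrier_mat q q" "Q\<^sup>T = Q" "Q * Q = 1\<^sub>m q"
    and "\<And>j. j < q \<Longrightarrow> Q $$ (0, j) = 1 / sqrt (real q)"
proof -
  (* The reflection is 1 - t w w^T, where w = (s, ..., s) - e_0 and t = 2 / |w|^2 = 1 / (1 - s).
     For q = 1 the vector w is 0, division by zero gives t = 0, and Q is the identity. *)
  define s where "s = 1 / sqrt (real q)"
  define w where "w j = s - (if j = 0 then 1 else 0)" for j :: nat
  define t where "t = 1 / (1 - s)"
  define Q where "Q = mat q q (\<lambda>(i, j). (if i = j then 1 else 0) - t * w i * w j)"
  have Q: "Q \<in> carrier_mat q q" by (simp add: Q_def)
  have s2: "real q * (s * s) = 1" using assms by (simp add: s_def)
  have "(\<Sum>l<q. w l * w l) = (\<Sum>l<q. s * s + (if l = 0 then 1 - 2 * s else 0))"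
    by (intro sum.cong) (auto simp: w_def algebra_simps)
  also have "\<dots> = 2 - 2 * s"
    using s2 assms by (simp add: sum.distrib)
  finally have norm_w: "(\<Sum>l<q. w l * w l) = 2 - 2 * s" .
  have t: "t * t * (2 - 2 * s) = 2 * t"
  proof (cases "s = 1")
    case False
    then have "t * (1 - s) = 1" by (simp add: t_def)
    moreover have "t * t * (2 - 2 * s) = 2 * t * (t * (1 - s))" by (simp add: algebra_simps)
    ultimately show ?thesis by simp
  qed (simp add: t_def)
  have "Q * Q = 1\<^sub>m q"
  proof (rule eq_matI)
    fix i j assume "i < dim_row (1\<^sub>m q :: real mat)" "j < dim_col (1\<^sub>m q :: real mat)"
    then have ij: "i < q" "j < q" by simp_all
    have "(Q * Q) $$ (i, j) = (\<Sum>l<q. Q $$ (i, l) * Q $$ (l, j))"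
      using ij Q by (simp add: scalar_prod_def atLeast0LessThan)
    also have "\<dots> = (\<Sum>l<q. (if l = i then (if i = j then 1 else 0) - t * w i * w j else 0)
        + ((if l = j then - (t * w i * w j) else 0) + t * t * w i * w j * (w l * w l)))"
      using ij by (intro sum.cong) (auto simp: Q_def algebra_simps)
    also have "\<dots> = (if i = j then 1 else 0) - 2 * t * w i * w j
        + t * t * w i * w j * (\<Sum>l<q. w l * w l)"
      using ij by (simp add: sum.distrib sum_distrib_left)
    also have "\<dots> = (if i = j then 1 else 0) + (t * t * (2 - 2 * s) - 2 * t) * (w i * w j)"
      unfolding norm_w by (simp add: algebra_simps)
    also have "\<dots> = (1\<^sub>m q :: real mat) $$ (i, j)" using ij t by simp
    finally show "(Q * Q) $$ (i, j) = (1\<^sub>m q :: real mat) $$ (i, j)" .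
  qed (simp_all add: Q_def)
  moreover have "Q\<^sup>T = Q" by (intro eq_matI) (auto simp: Q_def)
  moreover have "Q $$ (0, j) = 1 / sqrt (real q)" if "j < q" for j
  proof (cases "s = 1")
    case True
    then have "q = 1" by (simp add: s_def)
    then show ?thesis using that True by (simp add: Q_def t_def s_def)
  next
    case False
    then have "t * (s - 1) = -1" by (simp add: t_def field_simps)
    then have "t * w 0 * w j = - w j" by (simp add: w_def)
    then show ?thesis using that assms by (auto simp: Q_def s_def[symmetric] w_def)
  qed
  ultimately show thesis using that Q by blast
qed

text \<open>The right-hand side is the determinant of the matrix with \<open>a\<close> on and \<open>b\<close> off the diagonal,
  whose eigenvalues are \<open>a + r b\<close>, with eigenvector \<open>(1, \<dots>, 1)\<close>, and \<open>a - b\<close>, with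
  multiplicity \<open>r\<close>. The rows are replaced by their images under an orthogonal matrix whose first
  row is \<open>(1, \<dots>, 1) / \<surd>(r + 1)\<close>. The squared norms \<open>x i\<close> of the new rows have the sum
  \<open>(r + 1) a\<close>, while \<open>x 0 \<ge> a + r b\<close> by the bound on the entries. Dividing each \<open>x i\<close> by the
  eigenvalue that it would equal in the extremal case gives numbers with mean at most \<open>1\<close>, so
  their product is at most \<open>1\<close>, and Hadamard's inequality applies.\<close>

lemma gram_le_equiangular:
  assumes vs: "set vs \<subseteq> carrier_vec n" and len: "length vs = Suc r"
    and b: "0 \<le> b" "b < a"
    and diag: "\<And>i. i < length vs \<Longrightarrow> vs ! i \<bullet> vs ! i = a"
    and off: "\<And>i j. i < length vs \<Longrightarrow> j < length vs \<Longrightarrow> i \<noteq> j \<Longrightarrow> b \<le> vs ! i \<bullet> vs ! j"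
  shows "gram n vs \<le> (a + real r * b) * (a - b) ^ r"
proof -
  let ?q = "Suc r" and ?P = "a + real r * b"
  let ?A = "mat_of_rows n vs"
  let ?ip = "\<lambda>l m. vs ! l \<bullet> vs ! m"
  obtain Q :: "real mat" where Q: "Q \<in> carrier_mat ?q ?q" and sym: "Q\<^sup>T = Q"
    and inv: "Q * Q = 1\<^sub>m ?q"
    and row0: "\<And>j. j < ?q \<Longrightarrow> Q $$ (0, j) = 1 / sqrt (real ?q)"
    using involution_with_constant_first_row[of ?q] by auto
  have A: "?A \<in> carrier_mat ?q n" using mat_of_rows_carrier(1)[of n vs] len by simp
  define B where "B = Q * ?A"
  have B: "B \<in> carrier_mat ?q n" using Q A by (simp add: B_def)
  define x where "x i = row B i \<bullet> row B i" for i
  have x_nonneg: "0 \<le> x i" for i by (simp add: x_def scalar_prod_self_nonneg)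
  have "det Q * det Q = 1"
    using arg_cong[OF inv, of det] det_mult[OF Q Q] by simp
  then have "gram n vs = det (B * B\<^sup>T)"
    using det_gram_mult[OF A Q] by (simp add: gram_def B_def power2_eq_square)
  also have "\<dots> = gram n (rows B)"
    using B mat_of_rows_rows[of B] by (simp add: gram_def)
  also have "\<dots> \<le> prod_list (map (\<lambda>v. v \<bullet> v) (rows B))"
    using B rows_carrier[of B] by (intro gram_le_prod_norms) auto
  also have "\<dots> = (\<Prod>i<?q. x i)"
    using B by (simp add: prod.list_conv_set_nth x_def atLeast0LessThan)
  finally have had: "gram n vs \<le> (\<Prod>i<?q. x i)" .
  have x_eq: "x i = (\<Sum>l<?q. \<Sum>m<?q. Q $$ (i, l) * Q $$ (i, m) * ?ip l m)" if i: "i < ?q" for i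
  proof -
    have "x i = (\<Sum>j<n. (\<Sum>l<?q. Q $$ (i, l) * vs ! l $ j) * (\<Sum>m<?q. Q $$ (i, m) * vs ! m $ j))"
    proof -
      have "B $$ (i, j) = (\<Sum>l<?q. Q $$ (i, l) * vs ! l $ j)" if "j < n" for j
        using i that Q len unfolding B_def
        by (auto simp: scalar_prod_def mat_of_rows_index atLeast0LessThan intro!: sum.cong)
      then show ?thesis
        using B i by (auto simp: x_def scalar_prod_def atLeast0LessThan intro!: sum.cong)
    qed
    also have "\<dots> = (\<Sum>j<n. \<Sum>l<?q. \<Sum>m<?q.
        Q $$ (i, l) * Q $$ (i, m) * (vs ! l $ j * vs ! m $ j))"
      unfolding sum_product by (intro sum.cong refl) (simp add: mult_ac)
    also have "\<dots> = (\<Sum>l<?q. \<Sum>m<?q. \<Sum>j<n.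
        Q $$ (i, l) * Q $$ (i, m) * (vs ! l $ j * vs ! m $ j))"
      unfolding sum.swap[of _ "{..<?q}" "{..<n}"] ..
    also have "\<dots> = (\<Sum>l<?q. \<Sum>m<?q. Q $$ (i, l) * Q $$ (i, m) * ?ip l m)"
    proof (intro sum.cong refl)
      fix l m assume "l \<in> {..<?q}" "m \<in> {..<?q}"
      then have "vs ! m \<in> carrier_vec n" using vs len by (auto dest: nth_mem)
      then show "(\<Sum>j<n. Q $$ (i, l) * Q $$ (i, m) * (vs ! l $ j * vs ! m $ j))
          = Q $$ (i, l) * Q $$ (i, m) * ?ip l m"
        by (simp add: scalar_prod_def sum_distrib_left atLeast0LessThan)
    qed
    finally show ?thesis .
  qed
  have orth: "(\<Sum>i<?q. Q $$ (i, l) * Q $$ (i, m)) = (if l = m then 1 else 0)"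
    if "l < ?q" "m < ?q" for l m
  proof -
    have "(\<Sum>i<?q. Q $$ (i, l) * Q $$ (i, m)) = (Q\<^sup>T * Q) $$ (l, m)"
      using that Q by (simp add: scalar_prod_def atLeast0LessThan)
    then show ?thesis using that inv sym by simp
  qed
  have "(\<Sum>i<?q. x i) = (\<Sum>i<?q. \<Sum>l<?q. \<Sum>m<?q. Q $$ (i, l) * Q $$ (i, m) * ?ip l m)"
    by (intro sum.cong refl x_eq) auto
  also have "\<dots> = (\<Sum>l<?q. \<Sum>i<?q. \<Sum>m<?q. Q $$ (i, l) * Q $$ (i, m) * ?ip l m)"
    by (rule sum.swap)
  also have "\<dots> = (\<Sum>l<?q. \<Sum>m<?q. \<Sum>i<?q. Q $$ (i, l) * Q $$ (i, m) * ?ip l m)"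
    by (intro sum.cong refl sum.swap)
  also have "\<dots> = (\<Sum>l<?q. \<Sum>m<?q. if l = m then ?ip l m else 0)"
    by (intro sum.cong refl) (auto simp: sum_distrib_right[symmetric] orth simp del: sum.lessThan_Suc)
  also have "\<dots> = real ?q * a"
    using diag len by (simp del: sum.lessThan_Suc)
  finally have trace: "(\<Sum>i<?q. x i) = real ?q * a" .
  (* x 0 is the sum of all inner products, divided by q; each row sum is at least P *)
  have "?P \<le> (\<Sum>m<?q. ?ip l m)" if l: "l < ?q" for l
  proof -
    have "?P = (\<Sum>m<?q. b + (if m = l then a - b else 0))"
      using l by (simp add: sum.distrib algebra_simps del: sum.lessThan_Suc)
    also have "\<dots> \<le> (\<Sum>m<?q. ?ip l m)"
      using l len diag off by (intro sum_mono) auto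
    finally show ?thesis .
  qed
  then have "(\<Sum>l<?q. ?P) \<le> (\<Sum>l<?q. \<Sum>m<?q. ?ip l m)"
    by (intro sum_mono) auto
  then have "real ?q * ?P \<le> real ?q * x 0"
    using x_eq[of 0] row0
    by (simp add: sum_divide_distrib[symmetric] del: sum.lessThan_Suc)
  then have x0: "?P \<le> x 0" by simp
  have P: "0 < ?P" using b by (simp add: add_pos_nonneg)
  (* Moving mass from the other x i to x 0 lowers the sum of the y i because P >= a - b, and at
     x 0 = P that sum is exactly q. *)
  define y where "y i = x i / (if i = 0 then ?P else a - b)" for i
  have rest: "(\<Sum>i<r. x (Suc i)) = real ?q * a - x 0"
    using trace unfolding sum.lessThan_Suc_shift by simp
  have "(\<Sum>i<?q. y i) = x 0 / ?P + (real ?q * a - x 0) / (a - b)"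
    unfolding sum.lessThan_Suc_shift rest[symmetric] by (simp add: y_def sum_divide_distrib)
  also have "\<dots> = real ?q - (x 0 - ?P) * (1 / (a - b) - 1 / ?P)"
  proof -
    have "x 0 / p + (p + real r * d - x 0) / d = real ?q - (x 0 - p) * (1 / d - 1 / p)"
      if "0 < p" "0 < d" for p d
      using that by (simp add: field_simps)
    from this[OF P, of "a - b"] show ?thesis using b by (simp add: algebra_simps)
  qed
  also have "\<dots> \<le> real ?q"
  proof -
    have "a - b \<le> ?P" using b by (simp add: add_increasing2)
    then have "1 / ?P \<le> 1 / (a - b)" using b by (intro divide_left_mono) auto
    then have "0 \<le> (x 0 - ?P) * (1 / (a - b) - 1 / ?P)"
      using x0 by (intro mult_nonneg_nonneg) auto
    then show ?thesis by simp
  qed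
  finally have "(\<Prod>i<?q. y i) \<le> 1"
    using x_nonneg P b by (intro prod_le_1_if_sum_le_card) (auto simp: y_def)
  moreover have "(\<Prod>i<?q. y i) = (\<Prod>i<?q. x i) / (?P * (a - b) ^ r)"
    unfolding prod.lessThan_Suc_shift by (simp add: y_def prod_dividef)
  ultimately have "(\<Prod>i<?q. x i) \<le> ?P * (a - b) ^ r"
    using P b by (simp add: divide_le_eq)
  then show ?thesis using had by linarith
qed


section \<open>Grouping the rows of a 0-1 matrix\<close>

text \<open>The rows form a list because the argument reorders them and splits them into blocks.\<close>

definition zero_one_rows :: "nat \<Rightarrow> nat \<Rightarrow> real vec list \<Rightarrow> bool" where
  "zero_one_rows n k vs \<longleftrightarrow>
     (\<forall>v\<in>set vs. v \<in> carrier_vec n \<and> (\<forall>j<n. v $ j \<in> {0, 1}) \<and> (\<Sum>j<n. v $ j) = real k)"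

lemma zero_one_rows_carrier: "zero_one_rows n k vs \<Longrightarrow> set vs \<subseteq> carrier_vec n"
  by (auto simp: zero_one_rows_def)

lemma zero_one_rows_norm:
  assumes "zero_one_rows n k vs" and "v \<in> set vs"
  shows "v \<bullet> v = real k"
proof -
  have "dim_vec v = n" using assms by (auto simp: zero_one_rows_def)
  then have "v \<bullet> v = (\<Sum>j<n. v $ j * v $ j)"
    by (simp add: scalar_prod_def atLeast0LessThan)
  also have "\<dots> = (\<Sum>j<n. v $ j)"
    using assms by (intro sum.cong) (auto simp: zero_one_rows_def)
  finally show ?thesis using assms by (simp add: zero_one_rows_def)
qed

lemma zero_one_rows_common_column:
  assumes "zero_one_rows n k vs" and "u \<in> set vs" "v \<in> set vs"
    and "j < n" "u $ j = 1" "v $ j = 1"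
  shows "1 \<le> u \<bullet> v"
proof -
  have "0 \<le> u $ i * v $ i" if "i < n" for i
  proof -
    have "u $ i \<in> {0, 1}" "v $ i \<in> {0, 1}"
      using assms(1-3) that unfolding zero_one_rows_def by blast+
    then show ?thesis by auto
  qed
  then have "u $ j * v $ j \<le> (\<Sum>i<n. u $ i * v $ i)"
    using assms(4) by (intro member_le_sum) auto
  also have "\<dots> = u \<bullet> v"
    using zero_one_rows_carrier[OF assms(1)] assms(3)
    by (auto simp: scalar_prod_def atLeast0LessThan)
  finally show ?thesis using assms by simp
qed

lemma gram_zero_one_rows_le:
  assumes "zero_one_rows n k vs"
  shows "gram n vs \<le> real k ^ length vs"
proof -
  have "map (\<lambda>v. v \<bullet> v) vs = replicate (length vs) (real k)"
    using zero_one_rows_norm[OF assms] by (simp add: map_replicate_const cong: map_cong)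
  then show ?thesis
    using gram_le_prod_norms[OF zero_one_rows_carrier[OF assms]] by simp
qed

text \<open>For \<open>k = 1\<close> the value \<open>a - b\<close> of \<open>gram_le_equiangular\<close> vanishes, but then \<open>q = 1\<close> and
  Hadamard's inequality gives the bound.\<close>

lemma gram_common_column_le:
  assumes vs: "zero_one_rows n k vs" and j: "j < n" and col: "\<forall>v\<in>set vs. v $ j = 1"
    and len: "length vs = q" and q: "1 \<le> q" "q \<le> k"
  shows "gram n vs \<le> (real q + real k - 1) * (real k - 1) ^ (q - 1)"
proof (cases "k = 1")
  case True
  then show ?thesis using gram_zero_one_rows_le[OF vs] len q by simp
next
  case False
  obtain r where r: "q = Suc r" using q by (cases q) auto
  have "gram n vs \<le> (real k + real r * 1) * (real k - 1) ^ r"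
  proof (rule gram_le_equiangular[OF zero_one_rows_carrier[OF vs]])
    show "vs ! i \<bullet> vs ! i = real k" if "i < length vs" for i
      using zero_one_rows_norm[OF vs] that by simp
    show "1 \<le> vs ! i \<bullet> vs ! l" if "i < length vs" "l < length vs" for i l
      using zero_one_rows_common_column[OF vs _ _ j] col that by simp
  qed (use r len q False in auto)
  then show ?thesis using r by (simp add: add.commute)
qed

lemma sum_column_counts:
  assumes "zero_one_rows n k vs"
  shows "(\<Sum>j<n. length (filter (\<lambda>v. v $ j = 1) vs)) = length vs * k"
  using assms
proof (induction vs)
  case (Cons u us)
  have "real (\<Sum>j<n. if u $ j = 1 then 1 else 0) = (\<Sum>j<n. u $ j)"
    using Cons.prems unfolding of_nat_sum
    by (intro sum.cong) (auto simp: zero_one_rows_def)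
  also have "\<dots> = real k" using Cons.prems by (simp add: zero_one_rows_def)
  finally have "(\<Sum>j<n. if u $ j = 1 then 1 else 0) = k" by linarith
  moreover have "(\<Sum>j<n. length (filter (\<lambda>v. v $ j = 1) (u # us)))
      = (\<Sum>j<n. (if u $ j = 1 then 1 else 0) + length (filter (\<lambda>v. v $ j = 1) us))"
    by (intro sum.cong) auto
  moreover have "(\<Sum>j<n. length (filter (\<lambda>v. v $ j = 1) us)) = length us * k"
    using Cons by (simp add: zero_one_rows_def)
  ultimately show ?case by (simp add: sum.distrib)
qed simp

text \<open>Greedy grouping: \<open>g\<close> counts the removed blocks and \<open>r\<close> the rows that remain. While
  the remaining rows contain more than \<open>n (q - 1)\<close> ones, the pigeonhole principle gives a column
  with at least \<open>q\<close> of them, and Fischer's inequality splits off \<open>q\<close> such rows.\<close>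

lemma gram_zero_one_rows_grouped:
  assumes "zero_one_rows n k vs" and q: "1 \<le> q" "q \<le> k"
  defines "F \<equiv> (real q + real k - 1) * (real k - 1) ^ (q - 1)"
  shows "\<exists>g r. length vs = q * g + r \<and> r * k \<le> n * (q - 1)
    \<and> gram n vs \<le> F ^ g * real k ^ r"
  using assms(1)
proof (induction "length vs" arbitrary: vs rule: less_induct)
  case less
  have F: "0 \<le> F" using q by (simp add: F_def)
  show ?case
  proof (cases "length vs * k \<le> n * (q - 1)")
    case True
    then show ?thesis
      using gram_zero_one_rows_le[OF less.prems]
      by (intro exI[of _ 0] exI[of _ "length vs"]) simp
  next
    case False
    obtain j where j: "j < n" and many: "q \<le> length (filter (\<lambda>v. v $ j = 1) vs)"
    proof (rule ccontr)
      assume "\<not> thesis"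
      then have "length (filter (\<lambda>v. v $ j = 1) vs) \<le> q - 1" if "j < n" for j
        using that q \<open>j < n \<Longrightarrow> q \<le> length (filter (\<lambda>v. v $ j = 1) vs) \<Longrightarrow> thesis\<close> by force
      then have "(\<Sum>j<n. length (filter (\<lambda>v. v $ j = 1) vs)) \<le> (\<Sum>j<n. q - 1)"
        by (intro sum_mono) auto
      then show False
        using False sum_column_counts[OF less.prems] by simp
    qed
    define P where "P = (\<lambda>v. v $ j = (1 :: real))"
    define us where "us = take q (filter P vs)"
    define ws where "ws = drop q (filter P vs) @ filter (\<lambda>v. \<not> P v) vs"
    have mset: "mset vs = mset (us @ ws)"
      unfolding us_def ws_def append_assoc[symmetric] append_take_drop_id
      using multiset_partition[of "mset vs" P] by simp
    then have set: "set vs = set us \<union> set ws" by (metis mset_eq_setD set_append)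
    have us: "zero_one_rows n k us" and ws: "zero_one_rows n k ws"
      using less.prems set by (auto simp: zero_one_rows_def)
    have len_us: "length us = q" using many by (simp add: us_def P_def)
    have len: "length vs = q + length ws"
      using mset_eq_length[OF mset] len_us by simp
    with q have "length ws < length vs" by simp
    from less.hyps[OF this ws] obtain g r
      where gr: "length ws = q * g + r" "r * k \<le> n * (q - 1)"
        and gram_ws: "gram n ws \<le> F ^ g * real k ^ r" by blast
    have "\<forall>v\<in>set us. v $ j = 1"
      by (auto simp: us_def P_def dest!: in_set_takeD)
    then have gram_us: "gram n us \<le> F"
      unfolding F_def using gram_common_column_le[OF us j _ len_us q] by simp
    have "gram n vs = gram n (us @ ws)"
      using gram_mset_cong[OF _ mset] us ws by (simp add: zero_one_rows_carrier)
    also have "\<dots> \<le> gram n us * gram n ws"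
      using us ws by (intro gram_append_le zero_one_rows_carrier)
    also have "\<dots> \<le> F * (F ^ g * real k ^ r)"
      using gram_us gram_ws F gram_nonneg[OF zero_one_rows_carrier[OF ws]]
      by (intro mult_mono) auto
    finally have "gram n vs \<le> F ^ Suc g * real k ^ r" by (simp add: mult.assoc)
    then show ?thesis
      using len gr by (intro exI[of _ "Suc g"] exI[of _ r]) simp
  qed
qed

section \<open>Real exponents\<close>

text \<open>A block bound never exceeds the Hadamard bound for the same rows, so using more blocks
  improves the estimate. The induction step rests on
  \<open>(r + k + 1) (k - 1) = (r + k) k - (r + 1)\<close>.\<close>

lemma group_constant_le_power:
  assumes "1 \<le> k"
  shows "(real (Suc r) + real k - 1) * (real k - 1) ^ r \<le> real k ^ Suc r"
proof (induction r)
  case (Suc r)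
  have "(real (Suc (Suc r)) + real k - 1) * (real k - 1)
      \<le> (real (Suc r) + real k - 1) * real k"
    by (simp add: algebra_simps)
  then have "(real (Suc (Suc r)) + real k - 1) * (real k - 1) * (real k - 1) ^ r
      \<le> (real (Suc r) + real k - 1) * real k * (real k - 1) ^ r"
    using assms by (intro mult_right_mono) auto
  also have "\<dots> = real k * ((real (Suc r) + real k - 1) * (real k - 1) ^ r)"
    by (simp only: mult_ac)
  also have "\<dots> \<le> real k * real k ^ Suc r"
    using Suc by (intro mult_left_mono) auto
  finally show ?case by (simp only: power_Suc mult_ac)
qed simp

text \<open>The expression is \<open>s\<^sup>z (f / s\<^sup>q)\<^sup>y\<close>, hence antitone in \<open>y\<close>.\<close>

lemma powr_tradeoff:
  fixes f s :: real
  assumes "0 < f" "0 < s" and "f \<le> s ^ q" and "x \<le> y"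
  shows "f powr y * s powr (z - real q * y) \<le> f powr x * s powr (z - real q * x)"
proof -
  have "ln f \<le> ln (s ^ q)" using assms by (subst ln_le_cancel_iff) auto
  then have "(y - x) * (ln f - real q * ln s) \<le> 0"
    using assms by (intro mult_nonneg_nonpos) (auto simp: ln_realpow)
  then have "y * ln f + (z - real q * y) * ln s \<le> x * ln f + (z - real q * x) * ln s"
    by (simp add: algebra_simps)
  then show ?thesis
    using assms by (simp add: powr_def flip: exp_add)
qed

lemma Vol_R_le:
  assumes "A \<in> R m n k" and q: "1 \<le> q" "q \<le> k"
  shows "Vol A \<le> sqrt ((real q + real k - 1) * (real k - 1) ^ (q - 1))
            powr (real m / real q - real n / real k * ((real q - 1) / real q))
          * real k powr (real n * (real q - 1) / (2 * real k))"
proof -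
  define F where "F = (real q + real k - 1) * (real k - 1) ^ (q - 1)"
  define x where "x = real m / real q - real n / real k * ((real q - 1) / real q)"
  have A: "A \<in> carrier_mat m n" using assms by (simp add: R_def)
  have rows: "mat_of_rows n (rows A) = A" using A mat_of_rows_rows[of A] by simp
  have "row A i \<in> carrier_vec n \<and> (\<forall>j<n. row A i $ j \<in> {0, 1}) \<and> (\<Sum>j<n. row A i $ j) = real k"
    if "i < m" for i
    using assms A that by (auto simp: R_def)
  then have "zero_one_rows n k (rows A)"
    using A by (auto simp: zero_one_rows_def rows_def)
  from gram_zero_one_rows_grouped[OF this q] obtain g r
    where m: "m = q * g + r" and r: "r * k \<le> n * (q - 1)"
      and gram: "gram n (rows A) \<le> F ^ g * real k ^ r"
    using A by (auto simp: F_def)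
  have F: "0 < F"
  proof (cases "k = 1")
    case True
    with q show ?thesis by (simp add: F_def)
  next
    case False
    with q show ?thesis by (auto simp: F_def intro!: mult_pos_pos)
  qed
  have "F \<le> real k ^ q"
    using group_constant_le_power[of k "q - 1"] q by (simp add: F_def)
  then have f: "sqrt F \<le> sqrt (real k) ^ q"
    by (simp flip: real_sqrt_power)
  have "real (r * k) \<le> real (n * (q - 1))" using r by (simp only: of_nat_le_iff)
  then have "real r \<le> real n / real k * (real q - 1)"
    using q by (simp add: field_simps of_nat_diff)
  moreover have qx: "real q * x = real m - real n / real k * (real q - 1)"
    using q by (simp add: x_def field_simps)
  ultimately have "real q * x \<le> real q * real g" using m by simp
  then have xg: "x \<le> real g" using q by simp
  (* replace the integer g by the real exponent x, for which m - q x = n (q - 1) / k *)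
  have "Vol A = sqrt (gram n (rows A))" by (simp add: Vol_def gram_def rows)
  also have "\<dots> \<le> sqrt (F ^ g * real k ^ r)" using gram by simp
  also have "\<dots> = sqrt F powr real g * sqrt (real k) powr (real m - real q * real g)"
    using F q m by (simp add: real_sqrt_mult real_sqrt_power powr_realpow)
  also have "\<dots> \<le> sqrt F powr x * sqrt (real k) powr (real m - real q * x)"
    using F q f xg by (intro powr_tradeoff) auto
  also have "sqrt (real k) powr (real m - real q * x)
      = real k powr (real n * (real q - 1) / (2 * real k))"
    unfolding qx using q by (simp add: powr_half_sqrt[symmetric] powr_powr)
  finally show ?thesis by (simp add: F_def x_def)
qed

lemma det_le_Vol:
  assumes "A \<in> carrier_mat n n"
  shows "det A \<le> Vol A"
proof -
  have "det (A * A\<^sup>T) = (det A)\<^sup>2"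
    using assms by (simp add: det_mult[of _ n] det_transpose power2_eq_square)
  then show ?thesis by (simp add: Vol_def)
qed

text \<open>For \<open>q \<ge> 2\<close> the exponent of \<open>k - 1\<close> in \<open>c\<close> is nonzero, so \<open>rpow\<close> is the ordinary
  power; for \<open>q = 1\<close> both factors with base \<open>k - 1\<close> are \<open>1\<close>.\<close>

lemma c_power:
  assumes "1 \<le> q" "q \<le> k"
  shows "c q k ^ n = sqrt ((real q + real k - 1) * (real k - 1) ^ (q - 1))
            powr (real n / real q - real n / real k * ((real q - 1) / real q))
          * real k powr (real n * (real q - 1) / (2 * real k))"
proof -
  (* e is half the exponent of the square root, divided by n *)
  define e where "e = 1 / (2 * real q) * (1 - (real q - 1) / real k)"
  have pow: "(x powr a) ^ n = x powr (real n * a)" if "0 < x" for x a :: real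
    using that by (simp add: powr_realpow[symmetric] powr_powr mult.commute)
  have expo: "real n / real q - real n / real k * ((real q - 1) / real q) = 2 * (real n * e)"
    using assms by (simp add: e_def field_simps)
  have k: "(real k powr ((real q - 1) / (2 * real k))) ^ n
      = real k powr (real n * (real q - 1) / (2 * real k))"
    using assms by (simp add: pow)
  have a: "((real q + real k - 1) powr e) ^ n = (real q + real k - 1) powr (real n * e)"
    using assms by (intro pow) simp
  have b: "rpow (real k - 1) (1 / 2 * ((real q - 1) / real q) * (1 - (real q - 1) / real k)) ^ n
      = ((real k - 1) ^ (q - 1)) powr (real n * e)"
  proof (cases "q = 1")
    case True
    then show ?thesis by (simp add: rpow_def)
  next
    case False
    then have k1: "0 < real k - 1" and "1 - (real q - 1) / real k \<noteq> 0"
      using assms by (auto simp: field_simps)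
    then have "rpow (real k - 1) (1 / 2 * ((real q - 1) / real q) * (1 - (real q - 1) / real k))
        = (real k - 1) powr (real (q - 1) * e)"
      using False assms by (simp add: rpow_def e_def of_nat_diff)
    then show ?thesis
      using k1 by (simp add: pow powr_realpow[symmetric] powr_powr mult_ac)
  qed
  have "sqrt z powr (2 * (real n * e)) = z powr (real n * e)" if "0 \<le> z" for z
    using that by (simp add: powr_half_sqrt[symmetric] powr_powr)
  then show ?thesis
    using assms unfolding c_def power_mult_distrib e_def[symmetric] a b k expo
    by (simp add: powr_mult)
qed

theorem theorem4p3:
  fixes m n k q :: nat
  assumes "1 \<le> m" and "1 \<le> n" and "1 \<le> k"
    and "m \<le> n" and "k \<le> n"
    and "1 \<le> q" and "q \<le> k"
  shows "max_vol m n k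
      \<le> sqrt ((real q + real k - 1) * (real k - 1) ^ (q - 1))
            powr (real m / real q - real n / real k * ((real q - 1) / real q))
          * real k powr (real n * (real q - 1) / (2 * real k))
    \<and> max_det n k \<le> c q k ^ n"
proof
  have "Vol ` R m n k \<noteq> {}" using R_nonempty[OF assms(5)] by simp
  with finite_R Vol_R_le[OF _ assms(6,7)] show "max_vol m n k
      \<le> sqrt ((real q + real k - 1) * (real k - 1) ^ (q - 1))
            powr (real m / real q - real n / real k * ((real q - 1) / real q))
          * real k powr (real n * (real q - 1) / (2 * real k))"
    unfolding max_vol_def by (intro Max.boundedI) blast+
  have "det A \<le> c q k ^ n" if "A \<in> R n n k" for A
    using det_le_Vol[of A n] Vol_R_le[OF that assms(6,7)] that
    unfolding c_power[OF assms(6,7)] by (simp add: R_def)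
  then show "max_det n k \<le> c q k ^ n"
    unfolding max_det_def using finite_R R_nonempty[OF assms(5)]
    by (intro Max.boundedI) auto
qed

end
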